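(* Let $(\hat\lambda,\hat\mu)$ be any pair satisfying $$B^\top\hat\lambda+G^\top\hat\mu\le 0,\quad \hat\lambda\ge 0,\quad \hat\mu\ge 0,\quad \mathbf e^\top\hat\lambda\le 1.$$ Then the feasibility inequality $$0\ \ge\ d(y)^\top\hat\lambda+g^\top\hat\mu$$ is valid for (i.e. satisfied by) every $y$ whose recourse system is feasible, i.e. every $y$ for which there exists $x\ge 0$ with $Bx\ge d(y)$ and $Gx\ge g$.
   Context: Data: real matrices $A,B,G$ and real vectors $b,g$ of compatible dimensions; $d(y):=b-Ay$; $\{x\ge 0:\ Gx\ge g\}$ is assumed nonempty. $\mathbf e$ is the all-ones vector. The conditions on $(\hat\lambda,\hat\mu)$ are the constraints of the dual of $F(y):=\min_{x\ge 0,\ t\ge 0}\{t:\ Bx+t\,\mathbf e\ge d(y),\ Gx\ge g\}$. All vector inequalities are componentwise. *)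

theory Defs
  imports "HOL-Analysis.Analysis"
begin

text \<open>
  On \<^typ>\<open>real ^ 'n\<close> the relation \<open>\<le>\<close> is the componentwise (partial) order, and
  \<open>vec 1\<close> is the all-ones vector.
\<close>

definition recourse_rhs :: "real^'p^'m \<Rightarrow> real^'m \<Rightarrow> real^'p \<Rightarrow> real^'m"
  where "recourse_rhs A b y = b - A *v y"

definition recourse_feasible ::
  "real^'p^'m \<Rightarrow> real^'n^'m \<Rightarrow> real^'n^'k \<Rightarrow> real^'m \<Rightarrow> real^'k \<Rightarrow> real^'p \<Rightarrow> bool"
  where "recourse_feasible A B G b g y \<longleftrightarrow>
    (\<exists>x. x \<ge> 0 \<and> B *v x \<ge> recourse_rhs A b y \<and> G *v x \<ge> g)"

text \<open>
  The constraints of the linear-programming dual of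
  \<open>min {t. x \<ge> 0, t \<ge> 0, B x + t e \<ge> d(y), G x \<ge> g}\<close>.  The multipliers
  \<open>l\<close> and \<open>u\<close> belong to the rows of \<open>B\<close> and \<open>G\<close>; the
  last inequality is the dual constraint of the column of \<open>t\<close>.
\<close>

definition dual_feasible ::
  "real^'n^'m \<Rightarrow> real^'n^'k \<Rightarrow> real^'m \<Rightarrow> real^'k \<Rightarrow> bool"
  where "dual_feasible B G l u \<longleftrightarrow>
    transpose B *v l + transpose G *v u \<le> 0 \<and> l \<ge> 0 \<and> u \<ge> 0 \<and> vec 1 \<bullet> l \<le> 1"

end

theory Submission
  imports Defs
begin

text \<open>
  This is the weak-duality half of the Farkas lemma. Let \<open>x\<close> be a recourse decision for \<open>y\<close>.
  Weighting the rows of \<open>B x \<ge> d(y)\<close> and \<open>G x \<ge> g\<close> by the nonnegative multipliers \<open>l\<close> and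
  \<open>u\<close> bounds \<open>d(y) \<bullet> l + g \<bullet> u\<close> above by \<open>B x \<bullet> l + G x \<bullet> u\<close>. Moving the matrices to the
  multipliers turns this bound into \<open>x \<bullet> (B\<^sup>T l + G\<^sup>T u)\<close>, the product of a nonnegative vector
  and a nonpositive one. Hence a multiplier pair with \<open>d(y) \<bullet> l + g \<bullet> u > 0\<close> would certify
  that \<open>y\<close> has no feasible recourse.
\<close>

lemma inner_right_mono_vec:
  fixes v w z :: "real^'i"
  assumes "v \<le> w" and "0 \<le> z"
  shows "v \<bullet> z \<le> w \<bullet> z"
  using assms by (auto simp: inner_vec_def less_eq_vec_def intro!: sum_mono mult_right_mono)

lemma inner_matrix_vector_transpose:
  fixes M :: "real^'n^'m"
  shows "(M *v x) \<bullet> z = x \<bullet> (transpose M *v z)"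
  by (metis dot_lmul_matrix inner_commute transpose_matrix_vector)

theorem proposition1:
  fixes A :: "real^'p^'m" and B :: "real^'n^'m" and G :: "real^'n^'k"
    and b :: "real^'m" and g :: "real^'k"
    and l :: "real^'m" and u :: "real^'k"
  assumes "{x :: real^'n. x \<ge> 0 \<and> G *v x \<ge> g} \<noteq> {}"
    and "dual_feasible B G l u"
  shows "\<forall>y. recourse_feasible A B G b g y \<longrightarrow> 0 \<ge> recourse_rhs A b y \<bullet> l + g \<bullet> u"
proof (intro allI impI)
  fix y
  assume "recourse_feasible A B G b g y"
  then obtain x where x: "0 \<le> x" "recourse_rhs A b y \<le> B *v x" "g \<le> G *v x"
    by (auto simp: recourse_feasible_def)
  have dual: "transpose B *v l + transpose G *v u \<le> 0" "0 \<le> l" "0 \<le> u"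
    using assms(2) by (auto simp: dual_feasible_def)
  have "recourse_rhs A b y \<bullet> l + g \<bullet> u \<le> (B *v x) \<bullet> l + (G *v x) \<bullet> u"
    using x dual by (intro add_mono inner_right_mono_vec)
  also have "\<dots> = x \<bullet> (transpose B *v l) + x \<bullet> (transpose G *v u)"
    by (intro arg_cong2[where f = "(+)"] inner_matrix_vector_transpose)
  also have "\<dots> = (transpose B *v l + transpose G *v u) \<bullet> x"
    by (metis inner_add_right inner_commute)
  also have "\<dots> \<le> 0 \<bullet> x"
    using dual(1) x(1) by (rule inner_right_mono_vec)
  finally show "0 \<ge> recourse_rhs A b y \<bullet> l + g \<bullet> u"
    by simp
qed

end
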